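(* Let $D\subset\mathbb{C}$ be a circular domain and let $q\in\mathbb{C}[z]$ be a monic polynomial. Let $f,g\in\mathbb{C}[z]$ be monic polynomials of degree $n$ without common zeros in $q(D)$. (1) Given $y=(y_1,\dots,y_n)\in (q_\circ(D))^n$ with $S_{q,n}(g)(y)\neq 0$, there exists $z\in q(D)$ with $g(z)\neq 0$ such that $$\frac{S_{q,n}(f)(y)}{S_{q,n}(g)(y)}=\frac{f(z)}{g(z)}.$$ (2) If $|f/g|\geq 1$ on $q(D)$, then $$\left|\frac{S_{q,n}(f)}{S_{q,n}(g)}\right|\geq 1\quad\text{on } (q_\circ(D))^n.$$
   Context: A circular domain is an open or closed disk or halfspace (half-plane) in $\mathbb{C}$, or the complement of any such set. For a polynomial $q$ and a set $D\subset\mathbb{C}$, $q(D)$ is the image of $D$ under $q\colon\mathbb{C}\to\mathbb{C}$, and $q_\circ(D)=\{u\in\mathbb{C} : q^{-1}(u)\subset D\}$. $\mathbb{C}[z]_m$ is the space of complex polynomials of degree at most $m$. For $f=\sum_{k=0}^m a_kz^k$, $g=\sum_{k=0}^m b_kz^k$ in $\mathbb{C}[z]_m$, the Fischer inner product is $\langle f,g\rangle_m=\sum_{k=0}^m\frac{1}{\binom{m}{k}}a_k\overline{b_k}$. For $f=\sum_{k=0}^m a_kz^k$ regarded as an element of $\mathbb{C}[z]_m$, put $f^\vee(z)=f(-z)$, $f^\#(z)=z^m\overline{f(1/\overline{z})}=\sum_{k=0}^m\overline{a_{m-k}}z^k$ (this depends on $m$), and $f^{\#\vee}=(f^\#)^\vee$.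 For $q$ monic of degree $d$ and $f\in\mathbb{C}[z]_n$, define $$S_{q,n}(f)(u_1,\dots,u_n)=\Bigl\langle f\circ q,\ \prod_{j=1}^n(q-u_j)^{\#\vee}\Bigr\rangle_{nd},$$ where each $q-u_j$ is regarded as an element of $\mathbb{C}[z]_d$ when forming $(q-u_j)^{\#\vee}$. In (2), a quotient with nonzero numerator and vanishing denominator is regarded as having absolute value $\infty$.
   Formalization: Part (1) is stated only when D is convex or the quotient S(f)(y)/S(g)(y) is not 1; as written it fails for D={|z|>1}, q=z, f=z²+z, g=z², y=(2,−2), where the quotient is 1 but f/g=1+1/z never equals 1. *)

theory Defs
  imports "HOL-Analysis.Analysis" "HOL-Computational_Algebra.Polynomial"
begin

definition open_or_closed_disk :: "complex set \<Rightarrow> bool" where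
  "open_or_closed_disk C \<longleftrightarrow> (\<exists>a r. 0 < r \<and> (C = ball a r \<or> C = cball a r))"

definition open_or_closed_halfplane :: "complex set \<Rightarrow> bool" where
  "open_or_closed_halfplane C \<longleftrightarrow>
     (\<exists>a b. a \<noteq> 0 \<and> (C = {z. a \<bullet> z < b} \<or> C = {z. a \<bullet> z \<le> b}))"

definition circular_domain :: "complex set \<Rightarrow> bool" where
  "circular_domain D \<longleftrightarrow>
     (\<exists>C. (open_or_closed_disk C \<or> open_or_closed_halfplane C) \<and> (D = C \<or> D = - C))"

definition q_circ :: "complex poly \<Rightarrow> complex set \<Rightarrow> complex set" where
  "q_circ q D = {u. poly q -` {u} \<subseteq> D}"

text \<open>The operations below depend on the index \<open>m\<close> of the ambient space of polynomials of
  degree at most \<open>m\<close>, which is passed explicitly.\<close>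

definition fischer :: "nat \<Rightarrow> complex poly \<Rightarrow> complex poly \<Rightarrow> complex" where
  "fischer m f g = (\<Sum>k\<le>m. 1 / of_nat (m choose k) * coeff f k * cnj (coeff g k))"

definition vee :: "complex poly \<Rightarrow> complex poly" where
  "vee f = pcompose f [:0, -1:]"

definition sharp :: "nat \<Rightarrow> complex poly \<Rightarrow> complex poly" where
  "sharp m f = (\<Sum>k\<le>m. monom (cnj (coeff f (m - k))) k)"

text \<open>An \<open>n\<close>-tuple is a function on \<open>nat\<close> of which only the values below \<open>n\<close> are used,
  so the index is shifted by one with respect to \<open>u_1, \<dots>, u_n\<close>.\<close>

definition S :: "complex poly \<Rightarrow> nat \<Rightarrow> complex poly \<Rightarrow> (nat \<Rightarrow> complex) \<Rightarrow> complex" where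
  "S q n f u =
     fischer (n * degree q) (pcompose f q) (\<Prod>j<n. vee (sharp (degree q) (q - [:u j:])))"

text \<open>Absolute value of a quotient, infinite if only the denominator vanishes. In the
  indeterminate case \<open>0 / 0\<close> it is \<open>0\<close>, so a bound \<open>abs_quot a b \<ge> 1\<close> excludes this case.\<close>

definition abs_quot :: "complex \<Rightarrow> complex \<Rightarrow> ereal" where
  "abs_quot a b = (if b = 0 \<and> a \<noteq> 0 then \<infinity> else ereal (cmod (a / b)))"

text \<open>If \<open>f\<close> and \<open>g\<close> are monic of degree \<open>n\<close>, then \<open>f - g\<close> has degree less than \<open>n\<close>, that is,
  the value \<open>1\<close> of \<open>f / g\<close> is attained at infinity. For the exterior of a disk, the only kind of
  circular domain that is not convex, this value can therefore be a quotient
  \<open>S q n f y / S q n g y\<close> without being a value of \<open>f / g\<close> on \<open>q(D)\<close>. The following example shows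
  that it has to be excluded when \<open>D\<close> is not convex.\<close>

lemma quotient_one_exterior_counterexample:
  fixes D :: "complex set" and q f g :: "complex poly" and y :: "nat \<Rightarrow> complex"
  defines "D \<equiv> - cball 0 1" and "q \<equiv> [:0, 1:]" and "f \<equiv> [:0, 1, 1:]" and "g \<equiv> [:0, 0, 1:]"
    and "y \<equiv> (\<lambda>j. if j = 0 then 2 else -2)"
  shows "circular_domain D" "lead_coeff q = 1"
    "lead_coeff f = 1" "degree f = 2" "lead_coeff g = 1" "degree g = 2"
    "\<forall>w\<in>poly q ` D. \<not> (poly f w = 0 \<and> poly g w = 0)"
    "\<forall>j<2. y j \<in> q_circ q D" "S q 2 g y \<noteq> 0"
    "\<not> (\<exists>z\<in>poly q ` D. poly g z \<noteq> 0 \<and> S q 2 f y / S q 2 g y = poly f z / poly g z)"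
proof -
  show "circular_domain D"
    unfolding circular_domain_def open_or_closed_disk_def D_def
    by (metis zero_less_one)
  show "lead_coeff q = 1" "lead_coeff f = 1" "degree f = 2" "lead_coeff g = 1" "degree g = 2"
    by (simp_all add: q_def f_def g_def)
  show "\<forall>w\<in>poly q ` D. \<not> (poly f w = 0 \<and> poly g w = 0)"
    by (auto simp: D_def q_def f_def g_def)
  show "\<forall>j<2. y j \<in> q_circ q D"
    by (auto simp: q_circ_def q_def D_def y_def)
  have f': "pcompose f q = [:0, 1, 1:]" and g': "pcompose g q = [:0, 0, 1:]"
    by (simp_all add: f_def g_def q_def pcompose_pCons)
  have v: "vee (sharp 1 (q - [:c:])) = [:1, cnj c:]" for c
    by (simp add: vee_def sharp_def q_def monom_0 monom_Suc pcompose_pCons)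
  have p: "(\<Prod>j<2. vee (sharp 1 (q - [:y j:]))) = [:1, 0, -4:]"
    unfolding v by (simp add: numeral_2_eq_2 y_def)
  have d: "degree q = 1" by (simp add: q_def)
  have "S q 2 f y = -4" "S q 2 g y = -4"
    unfolding S_def d f' g' p fischer_def by (simp_all add: numeral_2_eq_2)
  then show "S q 2 g y \<noteq> 0"
    "\<not> (\<exists>z\<in>poly q ` D. poly g z \<noteq> 0 \<and> S q 2 f y / S q 2 g y = poly f z / poly g z)"
    by (auto simp: f_def g_def field_simps)
qed

end

theory Submission
  imports Defs "HOL-Computational_Algebra.Fundamental_Theorem_Algebra"
begin

text \<open>
  The Fischer product of \<open>p\<close> with \<open>h\<^sup>#\<^sup>\<or>\<close> is the apolarity pairing of \<open>p\<close> and \<open>h\<close>, that is, the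
  polarization of \<open>p\<close> at the zeros of \<open>h\<close>. Hence \<open>S q n f y - c * S q n g y\<close> is the polarization
  of \<open>f \<circ> q - c g \<circ> q\<close> at the zeros of \<open>\<Prod>(q - y\<^sub>j)\<close>, all of which lie in \<open>D\<close>. If it vanishes,
  Grace's theorem gives a zero of \<open>f \<circ> q - c g \<circ> q\<close> in \<open>D\<close>; the degree condition of Grace's
  theorem on non-convex domains holds because \<open>f\<close> and \<open>g\<close> are monic and \<open>c \<noteq> 1\<close>. Grace's theorem
  follows by iterating Laguerre's theorem, which is an averaging argument: inversion at a point
  of \<open>D\<close> maps the complement of \<open>D\<close> to a convex set.
\<close>

definition quad :: "real \<Rightarrow> complex \<Rightarrow> real \<Rightarrow> complex \<Rightarrow> real" where
  "quad a b c w = a * (w \<bullet> w) + b \<bullet> w + c"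

lemma quad_jensen:
  assumes "0 \<le> a" and W: "(\<Sum>i<m. w i) = of_nat m * W"
  shows "real m * quad a b c W \<le> (\<Sum>i<m. quad a b c (w i))"
proof -
  have s: "(\<Sum>i<m. v \<bullet> w i) = real m * (v \<bullet> W)" for v
  proof -
    have "(\<Sum>i<m. v \<bullet> w i) = v \<bullet> (\<Sum>i<m. w i)"
      by (simp add: inner_sum_right)
    also have "\<dots> = real m * (v \<bullet> W)"
      unfolding W by (simp add: inner_complex_def algebra_simps)
    finally show ?thesis .
  qed
  have "0 \<le> (\<Sum>i<m. (w i - W) \<bullet> (w i - W))"
    by (intro sum_nonneg) simp
  also have "\<dots> = (\<Sum>i<m. w i \<bullet> w i - 2 * (W \<bullet> w i) + W \<bullet> W)"
    by (intro sum.cong) (auto simp: inner_diff inner_commute algebra_simps)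
  also have "\<dots> = (\<Sum>i<m. w i \<bullet> w i) - real m * (W \<bullet> W)"
    by (simp add: sum.distrib sum_subtractf sum_distrib_left[symmetric] s)
  finally have "a * (real m * (W \<bullet> W)) \<le> a * (\<Sum>i<m. w i \<bullet> w i)"
    using assms(1) by (intro mult_left_mono) auto
  moreover have "(\<Sum>i<m. quad a b c (w i)) = a * (\<Sum>i<m. w i \<bullet> w i) + real m * (b \<bullet> W) + real m * c"
    by (simp add: quad_def sum.distrib sum_distrib_left[symmetric] s)
  ultimately show ?thesis
    by (simp add: quad_def algebra_simps)
qed

lemma quad_inversion:
  assumes "v \<noteq> 0"
  shows "quad A B C (z - v) =
    (v \<bullet> v) * quad (quad A B C z) (- cnj (of_real (2 * A) * z + B)) A (1 / v)"
proof -
  have n: "v \<bullet> v \<noteq> 0" using assms by simp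
  have 1: "(1 / v) \<bullet> (1 / v) = 1 / (v \<bullet> v)"
    by (simp add: power2_norm_eq_inner[symmetric] norm_divide power_divide)
  have 2: "(v \<bullet> v) * (cnj b \<bullet> (1 / v)) = b \<bullet> v" for b
  proof -
    have "(v \<bullet> v) * (cnj b \<bullet> u) = Re (of_real (v \<bullet> v) * (b * u))" for u
      by (simp add: inner_complex_def algebra_simps)
    then have "(v \<bullet> v) * (cnj b \<bullet> (1 / v)) = Re (of_real (v \<bullet> v) * (b * (1 / v)))" .
    also have "of_real (v \<bullet> v) = v * cnj v"
      by (simp add: complex_eq_iff inner_complex_def)
    also have "v * cnj v * (b * (1 / v)) = cnj v * b"
      using assms by simp
    also have "Re \<dots> = b \<bullet> v"
      by (simp add: inner_complex_def algebra_simps)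
    finally show ?thesis .
  qed
  have "(v \<bullet> v) * quad (quad A B C z) (- cnj (of_real (2 * A) * z + B)) A (1 / v)
      = quad A B C z - (of_real (2 * A) * z + B) \<bullet> v + A * (v \<bullet> v)"
    using n 2[of "of_real (2 * A) * z + B"]
    unfolding quad_def[of _ _ _ "1 / v"] 1 by (simp add: algebra_simps)
  also have "\<dots> = quad A B C (z - v)"
    by (simp add: quad_def inner_complex_def algebra_simps)
  finally show ?thesis by simp
qed

lemma circular_domain_quad:
  assumes "circular_domain D"
  shows "\<exists>A B C. (D = {z. quad A B C z > 0} \<or> D = {z. quad A B C z \<ge> 0}) \<and> (convex D \<longrightarrow> A \<le> 0)"
proof -
  obtain K where K: "open_or_closed_disk K \<or> open_or_closed_halfplane K" "D = K \<or> D = - K"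
    using assms unfolding circular_domain_def by blast
  from K(1) show ?thesis
  proof
    assume "open_or_closed_disk K"
    then obtain a r where r: "0 < r" "K = ball a r \<or> K = cball a r"
      unfolding open_or_closed_disk_def by blast
    have q: "(dist a z)\<^sup>2 - r\<^sup>2 = quad 1 (- (2 *\<^sub>R a)) (a \<bullet> a - r\<^sup>2) z" for z
      by (simp add: dist_norm power2_norm_eq_inner quad_def inner_diff inner_commute)
    have q': "r\<^sup>2 - (dist a z)\<^sup>2 = quad (-1) (2 *\<^sub>R a) (r\<^sup>2 - a \<bullet> a) z" for z
      by (simp add: dist_norm power2_norm_eq_inner quad_def inner_diff inner_commute)
    have lt: "dist a z < r \<longleftrightarrow> (dist a z)\<^sup>2 < r\<^sup>2" for z
      using r(1) by (metis abs_of_pos abs_le_square_iff linorder_not_le zero_le_dist abs_of_nonneg)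
    have le: "dist a z \<le> r \<longleftrightarrow> (dist a z)\<^sup>2 \<le> r\<^sup>2" for z
      using r(1) by (metis abs_of_pos abs_le_square_iff zero_le_dist abs_of_nonneg)
    have nc: "\<not> convex (- K)"
    proof
      assume "convex (- K)"
      moreover have "a + of_real (2 * r) \<in> - K" "a - of_real (2 * r) \<in> - K"
        using r by (auto simp: dist_norm)
      ultimately have "(1/2) *\<^sub>R (a + of_real (2 * r)) + (1/2) *\<^sub>R (a - of_real (2 * r)) \<in> - K"
        by (rule convexD) auto
      moreover have "(1/2) *\<^sub>R (a + of_real (2 * r)) + (1/2) *\<^sub>R (a - of_real (2 * r)) = a"
        by (simp add: complex_eq_iff add_divide_distrib diff_divide_distrib)
      ultimately show False using r by auto
    qed
    have "D = {z. quad (-1) (2 *\<^sub>R a) (r\<^sup>2 - a \<bullet> a) z > 0} \<or> D = {z. quad (-1) (2 *\<^sub>R a) (r\<^sup>2 - a \<bullet> a) z \<ge> 0}"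
      if "D = K"
      using that r(2) unfolding q'[symmetric] by (auto simp: lt le)
    moreover have "D = {z. quad 1 (- (2 *\<^sub>R a)) (a \<bullet> a - r\<^sup>2) z > 0} \<or> D = {z. quad 1 (- (2 *\<^sub>R a)) (a \<bullet> a - r\<^sup>2) z \<ge> 0}"
      if "D = - K"
      using that r(2) unfolding q[symmetric] by (auto simp: lt le)
    ultimately show ?thesis
      using K(2) nc by (metis neg_le_0_iff_le zero_le_one)
  next
    assume "open_or_closed_halfplane K"
    then obtain a b where K': "K = {z. a \<bullet> z < b} \<or> K = {z. a \<bullet> z \<le> b}"
      unfolding open_or_closed_halfplane_def by blast
    have "D = {z. quad 0 (- a) b z > 0} \<or> D = {z. quad 0 (- a) b z \<ge> 0}" if "D = K"
      using that K' by (auto simp: quad_def)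
    moreover have "D = {z. quad 0 a (- b) z > 0} \<or> D = {z. quad 0 a (- b) z \<ge> 0}" if "D = - K"
      using that K' by (auto simp: quad_def)
    ultimately show ?thesis
      using K(2) by (metis order_refl)
  qed
qed

lemma circular_domain_nontrivial:
  assumes "circular_domain D"
  shows "D \<noteq> {}" "D \<noteq> UNIV"
proof -
  obtain K where K: "open_or_closed_disk K \<or> open_or_closed_halfplane K" "D = K \<or> D = - K"
    using assms unfolding circular_domain_def by blast
  have "K \<noteq> {} \<and> K \<noteq> UNIV" using K(1)
  proof
    assume "open_or_closed_disk K"
    then obtain a r where r: "0 < r" "K = ball a r \<or> K = cball a r"
      unfolding open_or_closed_disk_def by blast
    then have "a \<in> K" "a + of_real (2 * r) \<notin> K"
      by (auto simp: dist_norm)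
    then show ?thesis by blast
  next
    assume "open_or_closed_halfplane K"
    then obtain a b where a: "a \<noteq> 0" and K': "K = {z. a \<bullet> z < b} \<or> K = {z. a \<bullet> z \<le> b}"
      unfolding open_or_closed_halfplane_def by blast
    define x where "x = (\<lambda>t. ((b + t) / (a \<bullet> a)) *\<^sub>R a)"
    have "a \<bullet> x t = b + t" for t
      using a by (simp add: x_def)
    from this[of "-1"] this[of 1] have "x (-1) \<in> K" "x 1 \<notin> K"
      using K' by auto
    then show ?thesis by blast
  qed
  then show "D \<noteq> {}" "D \<noteq> UNIV" using K(2) by auto
qed

lemma complex_poly_root_data:
  fixes p :: "complex poly"
  assumes "p \<noteq> 0"
  shows "\<exists>r. (\<forall>i<degree p. poly p (r i) = 0) \<and>
    (\<forall>z. poly p z \<noteq> 0 \<longrightarrow> poly (pderiv p) z = poly p z * (\<Sum>i<degree p. 1 / (z - r i))) \<and>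
    (0 < degree p \<longrightarrow> coeff p (degree p - 1) = - lead_coeff p * (\<Sum>i<degree p. r i))"
  using assms
proof (induction "degree p" arbitrary: p)
  case 0
  then obtain c where "p = [:c:]" by (metis degree_eq_zeroE)
  then show ?case by simp
next
  case (Suc k)
  then have "\<not> constant (poly p)"
    by (simp add: constant_degree)
  then obtain x where x: "poly p x = 0"
    using fundamental_theorem_of_algebra by blast
  then obtain s where p: "p = [:- x, 1:] * s"
    by (metis poly_eq_0_iff_dvd dvdE)
  then have s: "s \<noteq> 0" using Suc.prems by auto
  have k: "k = degree s"
    using Suc.hyps(2) s by (simp add: p degree_mult_eq del: mult_pCons_left)
  obtain r where r: "\<forall>i<degree s. poly s (r i) = 0"
    "\<forall>z. poly s z \<noteq> 0 \<longrightarrow> poly (pderiv s) z = poly s z * (\<Sum>i<degree s. 1 / (z - r i))"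
    "0 < degree s \<longrightarrow> coeff s (degree s - 1) = - lead_coeff s * (\<Sum>i<degree s. r i)"
    using Suc.hyps(1)[OF k s] by (elim exE conjE) (rule that)
  define r' where "r' = r(k := x)"
  have d: "degree p = Suc k" using Suc.hyps(2) by simp
  have sums: "(\<Sum>i<degree p. 1 / (z - r' i)) = (\<Sum>i<degree s. 1 / (z - r i)) + 1 / (z - x)"
    "(\<Sum>i<degree p. r' i) = (\<Sum>i<degree s. r i) + x" for z
    unfolding d by (auto simp: r'_def k)
  have "\<forall>i<degree p. poly p (r' i) = 0"
    unfolding d using r(1) k by (auto simp: r'_def p less_Suc_eq)
  moreover have "poly (pderiv p) z = poly p z * (\<Sum>i<degree p. 1 / (z - r' i))"
    if "poly p z \<noteq> 0" for z
  proof -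
    have z: "z - x \<noteq> 0" "poly s z \<noteq> 0" using that by (auto simp: p)
    have "poly (pderiv p) z = (z - x) * poly (pderiv s) z + poly s z"
      unfolding p pderiv_mult by (simp add: pderiv_pCons algebra_simps)
    moreover have "poly (pderiv s) z = poly s z * (\<Sum>i<degree s. 1 / (z - r i))"
      using r(2) z by blast
    moreover have "poly p z = (z - x) * poly s z"
      unfolding p by (simp add: algebra_simps)
    ultimately show ?thesis
      unfolding sums using z(1) by (simp add: distrib_left)
  qed
  moreover have "coeff p (degree p - 1) = - lead_coeff p * (\<Sum>i<degree p. r' i)"
  proof -
    have l: "lead_coeff p = lead_coeff s"
      unfolding p lead_coeff_mult by simp
    have "coeff p k = (if k = 0 then 0 else coeff s (k - 1)) - x * coeff s k"
      unfolding p by (simp add: coeff_pCons split: nat.split)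
    also have "(if k = 0 then 0 else coeff s (k - 1)) = - lead_coeff s * (\<Sum>i<degree s. r i)"
      using r(3) k by (cases "k = 0") auto
    finally have c: "coeff p k = - lead_coeff s * (\<Sum>i<degree s. r i) - x * coeff s k" .
    have e: "degree p - 1 = k" using d by simp
    show ?thesis
      unfolding l e c sums by (simp add: k algebra_simps)
  qed
  ultimately show ?case by blast
qed

definition polar_derivative :: "nat \<Rightarrow> complex \<Rightarrow> complex poly \<Rightarrow> complex poly" where
  "polar_derivative m x p = smult (of_nat m) p + [:x, -1:] * pderiv p"

lemma coeff_polar_derivative:
  "coeff (polar_derivative m x p) k = (of_nat m - of_nat k) * coeff p k + x * of_nat (Suc k) * coeff p (Suc k)"
  by (cases k) (simp_all add: polar_derivative_def coeff_pderiv algebra_simps)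

lemma degree_polar_derivative_le:
  assumes "degree p \<le> Suc m"
  shows "degree (polar_derivative (Suc m) x p) \<le> m"
proof (rule degree_le, intro allI impI)
  fix i assume i: "m < i"
  then have "coeff p (Suc i) = 0" using assms by (intro coeff_eq_0) simp
  moreover have "coeff p i = 0 \<or> i = Suc m"
    using i assms by (cases "i = Suc m") (auto intro: coeff_eq_0)
  ultimately show "coeff (polar_derivative (Suc m) x p) i = 0"
    by (auto simp: coeff_polar_derivative)
qed

text \<open>Since \<open>0\<close> is the image of \<open>\<infinity>\<close> under inversion, a polynomial of degree below \<open>Suc m\<close> is treated
  by padding the inverted zeros with zeros; this needs \<open>A \<le> 0\<close>, i.e. \<open>D\<close> convex.\<close>

lemma laguerre:
  assumes D: "D = {z. quad A B C z > 0} \<or> D = {z. quad A B C z \<ge> 0}"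
    and p: "\<And>w. w \<in> D \<Longrightarrow> poly p w \<noteq> 0"
    and deg: "degree p \<le> Suc m" "degree p = Suc m \<or> A \<le> 0"
    and x: "x \<in> D"
  shows "z \<in> D \<Longrightarrow> poly (polar_derivative (Suc m) x p) z \<noteq> 0"
    and "degree (polar_derivative (Suc m) x p) = m \<or> A \<le> 0"
proof -
  have "p \<noteq> 0" using p x by fastforce
  then obtain r where "\<forall>i<degree p. poly p (r i) = 0"
    "\<forall>z. poly p z \<noteq> 0 \<longrightarrow> poly (pderiv p) z = poly p z * (\<Sum>i<degree p. 1 / (z - r i))"
    "0 < degree p \<longrightarrow> coeff p (degree p - 1) = - lead_coeff p * (\<Sum>i<degree p. r i)"
    by (elim complex_poly_root_data[THEN exE] conjE) (rule that)
  note r = this[rule_format]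
  have rD: "r i \<notin> D" if "i < degree p" for i using r(1) p that by blast
  show "poly (polar_derivative (Suc m) x p) z \<noteq> 0" if z: "z \<in> D"
  proof
    assume 0: "poly (polar_derivative (Suc m) x p) z = 0"
    have pz: "poly p z \<noteq> 0" using p z by blast
    have "poly (polar_derivative (Suc m) x p) z =
        poly p z * (of_nat (Suc m) + (x - z) * (\<Sum>i<degree p. 1 / (z - r i)))"
      by (simp add: polar_derivative_def r(2)[OF pz] algebra_simps)
    then have "of_nat (Suc m) + (x - z) * (\<Sum>i<degree p. 1 / (z - r i)) = 0"
      using 0 pz by (metis mult_eq_0_iff)
    then have eq: "(z - x) * (\<Sum>i<degree p. 1 / (z - r i)) = of_nat (Suc m)"
      by (simp add: algebra_simps add_eq_0_iff)
    then have zx: "z - x \<noteq> 0" and k: "0 < degree p"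
      by (auto intro!: Nat.gr0I simp del: of_nat_Suc)
    define w where "w = (\<lambda>i. if i < degree p then 1 / (z - r i) else 0)"
    define \<Phi> where "\<Phi> = quad (quad A B C z) (- cnj (of_real (2 * A) * z + B)) A"
    have inv: "quad A B C u = ((z - u) \<bullet> (z - u)) * \<Phi> (1 / (z - u))" "0 < (z - u) \<bullet> (z - u)"
      if "u \<noteq> z" for u
      using quad_inversion[of "z - u" A B C z] that by (simp_all add: \<Phi>_def)
    have sgn: "0 < quad A B C u \<longleftrightarrow> 0 < \<Phi> (1 / (z - u))"
       "0 \<le> quad A B C u \<longleftrightarrow> 0 \<le> \<Phi> (1 / (z - u))" if "u \<noteq> z" for u
      using mult_less_cancel_left_pos[OF inv(2)[OF that], of 0] mult_le_cancel_left_pos[OF inv(2)[OF that], of 0]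
      by (simp_all only: inv(1)[OF that] mult_zero_right)
    have "(\<Sum>i<Suc m. w i) = (\<Sum>i<degree p. 1 / (z - r i))"
      using deg(1) by (intro sum.mono_neutral_cong_right) (auto simp: w_def)
    also have "\<dots> = of_nat (Suc m) * (1 / (z - x))"
      using eq zx by (simp add: field_simps)
    finally have W: "(\<Sum>i<Suc m. w i) = of_nat (Suc m) * (1 / (z - x))" .
    have "0 \<le> quad A B C z" using z D by auto
    then have J: "real (Suc m) * \<Phi> (1 / (z - x)) \<le> (\<Sum>i<Suc m. \<Phi> (w i))"
      unfolding \<Phi>_def using W by (rule quad_jensen)
    have rz: "r i \<noteq> z" if "i < degree p" for i using rD z that by blast
    have \<Phi>0: "\<Phi> 0 = A" by (simp add: \<Phi>_def quad_def)
    have le: "\<Phi> (w i) \<le> 0" if "i < Suc m" for i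
    proof (cases "i < degree p")
      case True
      then show ?thesis using rD[OF True] sgn[OF rz[OF True]] D
        by (auto simp: w_def)
    next
      case False
      then show ?thesis using that deg \<Phi>0 by (auto simp: w_def)
    qed
    have xz: "x \<noteq> z" using zx by auto
    show False
    proof (cases "D = {z. quad A B C z > 0}")
      case True
      then have "0 < \<Phi> (1 / (z - x))" using x sgn[OF xz] by auto
      then have "0 < real (Suc m) * \<Phi> (1 / (z - x))" by simp
      moreover have "(\<Sum>i<Suc m. \<Phi> (w i)) \<le> 0" using le by (intro sum_nonpos) auto
      ultimately show False using J by linarith
    next
      case False
      then have D': "D = {z. quad A B C z \<ge> 0}" using D by blast
      then have "0 \<le> \<Phi> (1 / (z - x))" using x sgn[OF xz] by auto
      then have "0 \<le> real (Suc m) * \<Phi> (1 / (z - x))" by simp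
      moreover have "\<Phi> (w 0) < 0"
        using rD[OF k] sgn[OF rz[OF k]] D' k by (auto simp: w_def)
      then have "(\<Sum>i<Suc m. \<Phi> (w i)) < (\<Sum>i<Suc m. 0)"
        using le by (intro sum_strict_mono_ex1) auto
      ultimately show False using J by simp
    qed
  qed
  show "degree (polar_derivative (Suc m) x p) = m \<or> A \<le> 0"
  proof (rule disjCI)
    assume A: "\<not> A \<le> 0"
    then have d: "degree p = Suc m" using deg by blast
    have "coeff (polar_derivative (Suc m) x p) m \<noteq> 0"
    proof
      assume 0: "coeff (polar_derivative (Suc m) x p) m = 0"
      have "coeff (polar_derivative (Suc m) x p) m = lead_coeff p * (of_nat (Suc m) * x - (\<Sum>i<Suc m. r i))"
        using r(3) unfolding coeff_polar_derivative by (simp add: d algebra_simps del: sum.lessThan_Suc)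
      then have W: "(\<Sum>i<Suc m. r i) = of_nat (Suc m) * x"
        using 0 \<open>p \<noteq> 0\<close> by simp
      have J: "real (Suc m) * quad A B C x \<le> (\<Sum>i<Suc m. quad A B C (r i))"
        using A W by (intro quad_jensen) auto
      show False
      proof (cases "D = {z. quad A B C z > 0}")
        case True
        then have "0 < real (Suc m) * quad A B C x" using x by simp
        moreover have "(\<Sum>i<Suc m. quad A B C (r i)) \<le> 0"
          using rD d True by (intro sum_nonpos) force
        ultimately show False using J by linarith
      next
        case False
        then have D': "D = {z. quad A B C z \<ge> 0}" using D by blast
        then have "0 \<le> real (Suc m) * quad A B C x" using x by simp
        moreover have "(\<Sum>i<Suc m. quad A B C (r i)) < (\<Sum>i<Suc m. 0)"
          using rD d D' by (intro sum_strict_mono) (auto simp: not_le)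
        ultimately show False using J by simp
      qed
    qed
    then show "degree (polar_derivative (Suc m) x p) = m"
      using degree_polar_derivative_le[of p m x] deg(1) le_degree by (metis le_antisym)
  qed
qed

definition apolar_form :: "nat \<Rightarrow> complex poly \<Rightarrow> complex poly \<Rightarrow> complex" where
  "apolar_form m p h = (\<Sum>k\<le>m. (-1) ^ k * coeff p k * coeff h (m - k) / of_nat (m choose k))"

lemma apolar_form_linear_factor:
  assumes "degree h \<le> m"
  shows "of_nat (Suc m) * apolar_form (Suc m) p ([:- x, 1:] * h) = apolar_form m (polar_derivative (Suc m) x p) h"
proof -
  let ?c = "\<lambda>k. (-1) ^ k * coeff p k / of_nat (Suc m choose k) :: complex"
  have c: "coeff ([:- x, 1:] * h) (Suc m - k) =
      (if k \<le> m then coeff h (m - k) else 0) - x * coeff h (Suc m - k)" if "k \<le> Suc m" for k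
    using that by (auto simp: coeff_pCons Suc_diff_le split: nat.split)
  have "apolar_form (Suc m) p ([:- x, 1:] * h) =
      (\<Sum>k\<le>Suc m. ?c k * (if k \<le> m then coeff h (m - k) else 0)) - (\<Sum>k\<le>Suc m. ?c k * (x * coeff h (Suc m - k)))"
    unfolding apolar_form_def sum_subtractf[symmetric]
    by (intro sum.cong refl, subst c) (auto simp: algebra_simps diff_divide_distrib)
  also have "(\<Sum>k\<le>Suc m. ?c k * (if k \<le> m then coeff h (m - k) else 0)) = (\<Sum>k\<le>m. ?c k * coeff h (m - k))"
    by simp
  also have "(\<Sum>k\<le>Suc m. ?c k * (x * coeff h (Suc m - k))) = (\<Sum>k\<le>m. ?c (Suc k) * (x * coeff h (m - k)))"
    using assms by (subst sum.atMost_Suc_shift) (simp add: coeff_eq_0 del: binomial_Suc_Suc)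
  finally have "of_nat (Suc m) * apolar_form (Suc m) p ([:- x, 1:] * h) =
      (\<Sum>k\<le>m. of_nat (Suc m) * (?c k * coeff h (m - k) - ?c (Suc k) * (x * coeff h (m - k))))"
    by (simp only: sum_subtractf[symmetric] sum_distrib_left)
  also have "\<dots> = apolar_form m (polar_derivative (Suc m) x p) h"
    unfolding apolar_form_def
  proof (intro sum.cong refl)
    fix k assume "k \<in> {..m}"
    then have k: "k \<le> m" by simp
    have n0: "(of_nat (Suc m choose k) :: complex) \<noteq> 0" "(of_nat (Suc m choose Suc k) :: complex) \<noteq> 0"
      "(of_nat (m choose k) :: complex) \<noteq> 0"
      using k by (simp_all del: binomial_Suc_Suc)
    have "Suc m * (m choose k) = (Suc m choose Suc k) * Suc k"
      by (rule Suc_times_binomial_eq)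
    then have e1: "(of_nat (Suc m) :: complex) * of_nat (m choose k) = of_nat (Suc m choose Suc k) * of_nat (Suc k)"
      by (metis of_nat_mult)
    have "(Suc m - k) * (Suc m choose k) = Suc m * (m choose k)"
      using binomial_absorb_comp[of "Suc m" k] by simp
    then have "(of_nat (Suc m - k) :: complex) * of_nat (Suc m choose k) = of_nat (Suc m) * of_nat (m choose k)"
      by (metis of_nat_mult)
    then have e2: "(of_nat (Suc m) - of_nat k :: complex) * of_nat (Suc m choose k) = of_nat (Suc m) * of_nat (m choose k)"
      using k by (simp add: of_nat_diff del: of_nat_Suc)
    have f1: "of_nat (Suc m) / of_nat (Suc m choose Suc k) = (of_nat (Suc k) / of_nat (m choose k) :: complex)"
      using e1 n0 by (simp add: divide_simps mult.commute del: binomial_Suc_Suc of_nat_Suc)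
    have f2: "of_nat (Suc m) / of_nat (Suc m choose k) = ((of_nat (Suc m) - of_nat k) / of_nat (m choose k) :: complex)"
      using e2 n0 by (simp add: divide_simps mult.commute del: binomial_Suc_Suc of_nat_Suc)
    have "of_nat (Suc m) * (?c k * coeff h (m - k) - ?c (Suc k) * (x * coeff h (m - k)))
      = (-1) ^ k * coeff h (m - k) * (of_nat (Suc m) / of_nat (Suc m choose k) * coeff p k
         + of_nat (Suc m) / of_nat (Suc m choose Suc k) * coeff p (Suc k) * x)"
      by (simp add: algebra_simps del: binomial_Suc_Suc of_nat_Suc)
    also have "\<dots> = (-1) ^ k * coeff (polar_derivative (Suc m) x p) k * coeff h (m - k) / of_nat (m choose k)"
      unfolding f1 f2 coeff_polar_derivative by (simp add: algebra_simps add_divide_distrib diff_divide_distrib del: of_nat_Suc)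
    finally show "of_nat (Suc m) * (?c k * coeff h (m - k) - ?c (Suc k) * (x * coeff h (m - k)))
      = (-1) ^ k * coeff (polar_derivative (Suc m) x p) k * coeff h (m - k) / of_nat (m choose k)" .
  qed
  finally show ?thesis .
qed

theorem grace:
  assumes D: "D = {z. quad A B C z > 0} \<or> D = {z. quad A B C z \<ge> 0}"
    and "D \<noteq> {}"
    and "\<And>w. w \<in> D \<Longrightarrow> poly p w \<noteq> 0"
    and "degree p \<le> m" and "degree p = m \<or> A \<le> 0"
    and "h \<noteq> 0" and "degree h = m" and "\<And>w. poly h w = 0 \<Longrightarrow> w \<in> D"
  shows "apolar_form m p h \<noteq> 0"
  using assms(3-)
proof (induction m arbitrary: p h)
  case 0
  then obtain a b where "p = [:a:]" "h = [:b:]"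
    by (metis degree_eq_zeroE le_0_eq)
  with 0 \<open>D \<noteq> {}\<close> show ?case by (auto simp: apolar_form_def)
next
  case (Suc m)
  then have "\<not> constant (poly h)"
    by (simp add: constant_degree)
  then obtain x where x: "poly h x = 0"
    using fundamental_theorem_of_algebra by blast
  then obtain s where h: "h = [:- x, 1:] * s"
    by (metis poly_eq_0_iff_dvd dvdE)
  then have s: "s \<noteq> 0" using Suc.prems by auto
  have m: "degree s = m"
    using Suc.prems(5) s unfolding h by (subst (asm) degree_mult_eq) auto
  have xD: "x \<in> D" using Suc.prems x by blast
  note L = laguerre[OF D Suc.prems(1-3) xD]
  have "apolar_form m (polar_derivative (Suc m) x p) s \<noteq> 0"
    using L Suc.prems(6) s m degree_polar_derivative_le[OF Suc.prems(2)]
    by (intro Suc.IH) (auto simp: h)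
  then show ?case
    using apolar_form_linear_factor[of s m p x] m unfolding h by auto
qed

lemma coeff_sharp: "coeff (sharp m f) k = (if k \<le> m then cnj (coeff f (m - k)) else 0)"
  by (simp add: sharp_def coeff_sum)

lemma coeff_vee: "coeff (vee f) k = (-1) ^ k * coeff f k"
  by (simp add: vee_def coeff_pcompose_linear)

lemma fischer_vee_sharp: "fischer m p (vee (sharp m h)) = apolar_form m p h"
  by (simp add: fischer_def apolar_form_def coeff_vee coeff_sharp mult_ac)

lemma poly_sharp:
  assumes "degree f \<le> m" "z \<noteq> 0"
  shows "poly (sharp m f) z = z ^ m * cnj (poly f (1 / cnj z))"
proof -
  have f: "poly f y = (\<Sum>k\<le>m. coeff f k * y ^ k)" for y
    using arg_cong[OF poly_as_sum_of_monoms'[OF assms(1)], of "\<lambda>p. poly p y"]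
    by (simp add: poly_sum poly_monom)
  have "poly (sharp m f) z = (\<Sum>k\<le>m. cnj (coeff f (m - k)) * z ^ k)"
    by (simp add: sharp_def poly_sum poly_monom)
  also have "\<dots> = (\<Sum>k\<le>m. cnj (coeff f k) * z ^ (m - k))"
    by (rule sum.reindex_bij_witness[of _ "\<lambda>k. m - k" "\<lambda>k. m - k"]) auto
  also have "\<dots> = (\<Sum>k\<le>m. z ^ m * cnj (coeff f k * (1 / cnj z) ^ k))"
    using assms(2) by (intro sum.cong) (auto simp: power_diff field_simps)
  also have "\<dots> = z ^ m * cnj (poly f (1 / cnj z))"
    by (simp add: f sum_distrib_left)
  finally show ?thesis .
qed

lemma sharp_mult:
  assumes "degree f \<le> a" "degree g \<le> b"
  shows "sharp (a + b) (f * g) = sharp a f * sharp b g"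
proof -
  have "degree (f * g) \<le> a + b"
    using degree_mult_le[of f g] assms by linarith
  then have "poly (sharp (a + b) (f * g)) z = poly (sharp a f * sharp b g) z" if "z \<noteq> 0" for z
    using that assms by (simp add: poly_sharp power_add)
  then have "poly ([:0, 1:] * sharp (a + b) (f * g)) z = poly ([:0, 1:] * (sharp a f * sharp b g)) z" for z
    by (cases "z = 0") simp_all
  then have "[:0, 1:] * sharp (a + b) (f * g) = [:0, 1:] * (sharp a f * sharp b g)"
    by (simp only: poly_eq_poly_eq_iff[symmetric] fun_eq_iff) simp
  then show ?thesis
    by simp
qed

lemma vee_sharp_prod:
  assumes "\<And>j. j < n \<Longrightarrow> degree (f j) \<le> d"
  shows "(\<Prod>j<n. vee (sharp d (f j))) = vee (sharp (n * d) (\<Prod>j<n. f j))"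
  using assms
proof (induction n)
  case 0
  show ?case by (simp add: sharp_def vee_def monom_0)
next
  case (Suc n)
  have "degree (\<Prod>j<n. f j) \<le> (\<Sum>j<n. degree (f j))"
    using degree_prod_sum_le[of "{..<n}" f] by (simp add: o_def)
  also have "\<dots> \<le> n * d"
    using sum_bounded_above[of "{..<n}" "\<lambda>j. degree (f j)" d] Suc.prems by simp
  finally have "sharp (n * d + d) ((\<Prod>j<n. f j) * f n) = sharp (n * d) (\<Prod>j<n. f j) * sharp d (f n)"
    using Suc.prems by (intro sharp_mult) auto
  then show ?case
    using Suc by (simp add: vee_def pcompose_mult add.commute)
qed

lemma S_eq_apolar_form:
  "S q n f u = apolar_form (n * degree q) (pcompose f q) (\<Prod>j<n. q - [:u j:])"
proof -
  have "degree (q - [:c:]) \<le> degree q" for c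
    by (rule degree_diff_le) auto
  then show ?thesis
    by (simp add: S_def vee_sharp_prod fischer_vee_sharp)
qed

lemma apolar_form_prod_nonzero:
  assumes D: "circular_domain D"
    and u: "\<And>j. j < n \<Longrightarrow> u j \<in> q_circ q D"
    and p: "\<And>w. w \<in> D \<Longrightarrow> poly p w \<noteq> 0"
    and deg: "degree p \<le> n * degree q" "degree p = n * degree q \<or> convex D"
  shows "apolar_form (n * degree q) p (\<Prod>j<n. q - [:u j:]) \<noteq> 0"
proof -
  obtain A B C where ABC: "D = {z. quad A B C z > 0} \<or> D = {z. quad A B C z \<ge> 0}" "convex D \<longrightarrow> A \<le> 0"
    using circular_domain_quad[OF D] by blast
  have n0: "q - [:u j:] \<noteq> 0" if "j < n" for j
  proof
    assume "q - [:u j:] = 0"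
    then have "q = [:u j:]" by simp
    then have "poly q -` {u j} = UNIV" by (metis poly_const_conv UNIV_eq_I vimage_singleton_eq)
    then have "D = UNIV" using u[OF that] by (auto simp: q_circ_def)
    then show False using circular_domain_nontrivial[OF D] by simp
  qed
  have d: "degree (q - [:c:]) = degree q" for c
  proof (cases "degree q = 0")
    case True
    then show ?thesis using degree_diff_le[of q 0 "[:c:]"] by simp
  next
    case False
    then show ?thesis unfolding diff_conv_add_uminus by (intro degree_add_eq_left) simp
  qed
  show ?thesis
  proof (rule grace[OF ABC(1) circular_domain_nontrivial(1)[OF D] p deg(1)])
    show "degree p = n * degree q \<or> A \<le> 0" using deg ABC by blast
    show "(\<Prod>j<n. q - [:u j:]) \<noteq> 0" using n0 by simp
    have "degree (\<Prod>j<n. q - [:u j:]) = (\<Sum>j<n. degree (q - [:u j:]))"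
      using n0 by (intro degree_prod_eq_sum_degree) auto
    then show "degree (\<Prod>j<n. q - [:u j:]) = n * degree q" by (simp add: d)
    show "w \<in> D" if "poly (\<Prod>j<n. q - [:u j:]) w = 0" for w
      using that u by (auto simp: poly_prod q_circ_def)
  qed
qed

theorem corollary3p7:
  fixes D :: "complex set" and q f g :: "complex poly" and n :: nat
  assumes "circular_domain D"
    and "lead_coeff q = 1"
    and "lead_coeff f = 1" and "degree f = n"
    and "lead_coeff g = 1" and "degree g = n"
    and "\<forall>w\<in>poly q ` D. \<not> (poly f w = 0 \<and> poly g w = 0)"
  shows "(\<forall>y :: nat \<Rightarrow> complex.
            (\<forall>j<n. y j \<in> q_circ q D) \<longrightarrow> S q n g y \<noteq> 0 \<longrightarrow>
            (convex D \<or> S q n f y / S q n g y \<noteq> 1) \<longrightarrow>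
            (\<exists>z\<in>poly q ` D. poly g z \<noteq> 0 \<and>
               S q n f y / S q n g y = poly f z / poly g z)) \<and>
         ((\<forall>z\<in>poly q ` D. abs_quot (poly f z) (poly g z) \<ge> 1) \<longrightarrow>
          (\<forall>y :: nat \<Rightarrow> complex.
            (\<forall>j<n. y j \<in> q_circ q D) \<longrightarrow>
            abs_quot (S q n f y) (S q n g y) \<ge> 1))"
proof -
  have attained: "\<exists>z\<in>poly q ` D. poly g z \<noteq> 0 \<and> S q n f y / S q n g y = poly f z / poly g z"
    if y: "\<forall>j<n. y j \<in> q_circ q D" and g0: "S q n g y \<noteq> 0"
      and c1: "convex D \<or> S q n f y / S q n g y \<noteq> 1" for y
  proof -
    define c where "c = S q n f y / S q n g y"
    define p where "p = pcompose f q - smult c (pcompose g q)"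
    have "apolar_form (n * degree q) p (\<Prod>j<n. q - [:y j:]) = S q n f y - c * S q n g y"
      by (simp add: S_eq_apolar_form apolar_form_def p_def sum_distrib_left sum_subtractf[symmetric]
          algebra_simps diff_divide_distrib)
    also have "\<dots> = 0" using g0 by (simp add: c_def)
    finally have ap: "apolar_form (n * degree q) p (\<Prod>j<n. q - [:y j:]) = 0" .
    have le: "degree p \<le> n * degree q"
      unfolding p_def using assms
      by (intro degree_diff_le order.trans[OF degree_smult_le]) (simp_all add: degree_pcompose)
    have "degree p = n * degree q" if "c \<noteq> 1"
    proof (cases "degree q = 0")
      case True
      then show ?thesis using le by simp
    next
      case False
      then have "coeff (pcompose f q) (n * degree q) = 1" "coeff (pcompose g q) (n * degree q) = 1"
        using assms lead_coeff_comp[of q f] lead_coeff_comp[of q g] by (simp_all add: degree_pcompose)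
      then have "coeff p (n * degree q) \<noteq> 0" using that by (simp add: p_def)
      then show ?thesis using le le_degree by (metis le_antisym)
    qed
    then have "degree p = n * degree q \<or> convex D" using c1 by (auto simp: c_def)
    then obtain w where w: "w \<in> D" "poly p w = 0"
      using apolar_form_prod_nonzero[OF assms(1) _ _ le, of y] y ap by blast
    have fg: "poly f (poly q w) = c * poly g (poly q w)"
      using w(2) by (simp add: p_def poly_pcompose)
    then have "poly g (poly q w) \<noteq> 0"
      using assms(7) w(1) by auto
    then show ?thesis using fg w(1) unfolding c_def[symmetric] by (intro bexI[of _ "poly q w"]) auto
  qed
  moreover have "abs_quot (S q n f y) (S q n g y) \<ge> 1"
    if fg: "\<forall>z\<in>poly q ` D. abs_quot (poly f z) (poly g z) \<ge> 1"
      and y: "\<forall>j<n. y j \<in> q_circ q D" for y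
  proof -
    have "poly (pcompose f q) w \<noteq> 0" if "w \<in> D" for w
      using fg that by (force simp: abs_quot_def poly_pcompose)
    then have f0: "S q n f y \<noteq> 0"
      using assms y unfolding S_eq_apolar_form
      by (intro apolar_form_prod_nonzero[OF assms(1)]) (auto simp: degree_pcompose)
    show ?thesis
    proof (cases "S q n g y = 0 \<or> S q n f y / S q n g y = 1")
      case True
      then show ?thesis using f0 by (auto simp: abs_quot_def)
    next
      case False
      then obtain z where "z \<in> poly q ` D" "poly g z \<noteq> 0" "S q n f y / S q n g y = poly f z / poly g z"
        using attained y by blast
      then show ?thesis using fg False by (auto simp: abs_quot_def)
    qed
  qed
  ultimately show ?thesis by blast
qed

end
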